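(* For every $p\in[0,1/2]$, the $\mathrm{AOS}p$ greedy-based algorithm for online weighted bipartite matching with one-sided vertex arrivals is $p(1-p)$-competitive in the $\mathrm{AOS}p$ model (adversarial-order model with $p$-sampling).
   Context: $\mathrm{AOS}p$ model for bipartite matching with vertex arrivals: (1) The adversary generates a finite bipartite graph $G=(L,R,E)$ with weights $w:E\to\mathbb{R}_{\ge0}$ (ties broken by a fixed consistent rule, so edge weights are totally ordered). (2) Each $u\in L$ is put in the history set $H$ independently with probability $p$; the value $p$ and the subgraph induced on $H\cup R$ are given to the online player upfront. The online set is $O=L\setminus H$. (3) The vertices of $O$ arrive one by one in an adversarial order (which may depend on $H$). When a vertex arrives, its incident edges and their weights are revealed, and the player must immediately and irrevocably match it to an unmatched neighbor or leave it unmatched. For $U\subseteq L$, $G[U]$ denotes the subgraph induced on $U\cup R$. $\mathrm{OPT}$ is the (random) maximum weight of a matching in $G[O]$. An algorithm is $c$-competitive if $\mathrm{E}[\mathrm{ALG}]\ge c\cdot\mathrm{E}[\mathrm{OPT}]$ on every instance $(G,p)$, where $\mathrm{ALG}$ is the weight of its output matching and expectations are over $H$ and the algorithm's internal randomness. $\mathrm{Greedy}(K)$: process the edges of $K$ in non-increasing order of weight, adding an edge to the matching iff neither endpoint is already covered. $\mathrm{AOS}p$ greedy-based algorithm: set $L'=H$, $M=\emptyset$. When $u\in O$ arrives, compute $\mathrm{Greedy}(G[L'\cup\{u\}])$; if $u$ is matched in it by an edge $(u,r)$ and $r$ is not yet matched in $M$, add $(u,r)$ to $M$. Output $M$. *)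

theory Defs
  imports "HOL-Probability.Probability" "HOL-Probability.Product_PMF"
begin

section \<open>Weighted bipartite graphs and matchings\<close>

text \<open>The two sides live in different types, so they are disjoint by typing.\<close>

record ('l, 'r) wgraph =
  left :: "'l set"
  right :: "'r set"
  edges :: "('l \<times> 'r) set"
  weight :: "'l \<times> 'r \<Rightarrow> real"

definition bipartite_wgraph :: "('l, 'r) wgraph \<Rightarrow> bool" where
  "bipartite_wgraph G \<longleftrightarrow>
     finite (left G) \<and> finite (right G) \<and> edges G \<subseteq> left G \<times> right G \<and>
     (\<forall>e \<in> edges G. 0 \<le> weight G e)"

text \<open>Weights outside the induced edge set are erased, so that handing an induced subgraph to the
  online player reveals nothing about the remaining edges.\<close>

definition induced :: "('l, 'r) wgraph \<Rightarrow> 'l set \<Rightarrow> ('l, 'r) wgraph" where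
  "induced G U =
     (let E' = {e \<in> edges G. fst e \<in> U}
      in \<lparr>left = left G \<inter> U, right = right G, edges = E', weight = restrict (weight G) E'\<rparr>)"

definition matching :: "('l, 'r) wgraph \<Rightarrow> ('l \<times> 'r) set \<Rightarrow> bool" where
  "matching K M \<longleftrightarrow> M \<subseteq> edges K \<and> inj_on fst M \<and> inj_on snd M"

definition max_matching_weight :: "('l, 'r) wgraph \<Rightarrow> real" where
  "max_matching_weight K = Max (sum (weight K) ` {M. matching K M})"


section \<open>Greedy matching\<close>

text \<open>The tie-breaking rule is a linear order \<open>tb\<close> on all potential edges; edges of equal weight
  are processed in the order given by \<open>tb\<close>.\<close>

definition processed_before ::
    "('l \<times> 'r) rel \<Rightarrow> ('l, 'r) wgraph \<Rightarrow> 'l \<times> 'r \<Rightarrow> 'l \<times> 'r \<Rightarrow> bool" where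
  "processed_before tb K e f \<longleftrightarrow>
     weight K e > weight K f \<or> (weight K e = weight K f \<and> (e, f) \<in> tb)"

definition edge_list :: "('l \<times> 'r) rel \<Rightarrow> ('l, 'r) wgraph \<Rightarrow> ('l \<times> 'r) list" where
  "edge_list tb K =
     (THE es. distinct es \<and> set es = edges K \<and> sorted_wrt (processed_before tb K) es)"

definition greedy_add :: "'l \<times> 'r \<Rightarrow> ('l \<times> 'r) set \<Rightarrow> ('l \<times> 'r) set" where
  "greedy_add e M = (if fst e \<notin> fst ` M \<and> snd e \<notin> snd ` M then insert e M else M)"

definition greedy :: "('l \<times> 'r) rel \<Rightarrow> ('l, 'r) wgraph \<Rightarrow> ('l \<times> 'r) set" where
  "greedy tb K = fold greedy_add (edge_list tb K) {}"

text \<open>The description defining \<^const>\<open>edge_list\<close> is proper.\<close>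

lemma edge_list_unique_exists:
  fixes tb :: "('l \<times> 'r) rel" and K :: "('l, 'r) wgraph"
  assumes tb: "linear_order tb" and fin: "finite (edges K)"
  shows "\<exists>!es. distinct es \<and> set es = edges K \<and> sorted_wrt (processed_before tb K) es"
proof -
  let ?P = "processed_before tb K"
  have tb': "refl tb" "trans tb" "antisym tb" "total tb"
    using tb by (simp_all only: order_on_defs)
  have rf: "(x, x) \<in> tb" for x
    using tb'(1) by (rule reflD)
  have tr: "(x, z) \<in> tb" if "(x, y) \<in> tb" "(y, z) \<in> tb" for x y z
    using tb'(2) that by (rule transD)
  have as: "x = y" if "(x, y) \<in> tb" "(y, x) \<in> tb" for x y
    using tb'(3) that by (rule antisymD)
  have tot: "(x, y) \<in> tb \<or> (y, x) \<in> tb" for x y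
    using tb'(4) rf[of x] unfolding total_on_def by (metis UNIV_I)
  interpret P: linorder ?P "\<lambda>x y. ?P x y \<and> x \<noteq> y"
  proof
    fix x y z
    show "(?P x y \<and> x \<noteq> y) = (?P x y \<and> \<not> ?P y x)"
      using as[of x y] rf by (auto simp: processed_before_def)
    show "?P x x" by (simp add: processed_before_def rf)
    show "?P x z" if "?P x y" "?P y z"
      using that tr[of x y z] by (auto simp: processed_before_def)
    show "x = y" if "?P x y" "?P y x"
      using that as[of x y] by (auto simp: processed_before_def)
    show "?P x y \<or> ?P y x"
      using tot[of x y] by (auto simp: processed_before_def)
  qed
  show ?thesis
    using P.finite_sorted_distinct_unique[OF fin] by (simp add: conj_ac)
qed


section \<open>The adversarial-order model with sampling\<close>

text \<open>A player's policy receives the sampling probability, the history set \<open>H\<close>, the weighted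
  subgraph revealed so far (induced on \<open>H\<close>, the earlier arrivals and the current vertex), the list of
  earlier arrivals, the current vertex, and the current matching; it returns a distribution over
  decisions: \<open>Some r\<close> to match the current vertex to \<open>r\<close>, or \<open>None\<close> to leave it unmatched.\<close>

type_synonym ('l, 'r) policy =
  "real \<Rightarrow> 'l set \<Rightarrow> ('l, 'r) wgraph \<Rightarrow> 'l list \<Rightarrow> 'l \<Rightarrow> ('l \<times> 'r) set \<Rightarrow> 'r option pmf"

text \<open>Infeasible decisions leave the arriving vertex unmatched.\<close>

definition apply_decision ::
    "('l, 'r) wgraph \<Rightarrow> 'l \<Rightarrow> 'r option \<Rightarrow> ('l \<times> 'r) set \<Rightarrow> ('l \<times> 'r) set" where
  "apply_decision G u d M =
     (case d of
        None \<Rightarrow> M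
      | Some r \<Rightarrow> if (u, r) \<in> edges G \<and> r \<notin> snd ` M then insert (u, r) M else M)"

primrec run_policy ::
    "('l, 'r) policy \<Rightarrow> real \<Rightarrow> ('l, 'r) wgraph \<Rightarrow> 'l set \<Rightarrow> 'l list \<Rightarrow> 'l list \<Rightarrow>
     ('l \<times> 'r) set \<Rightarrow> ('l \<times> 'r) set pmf" where
  "run_policy A p G H past [] M = return_pmf M"
| "run_policy A p G H past (u # us) M =
     bind_pmf (A p H (induced G (H \<union> set past \<union> {u})) past u M)
       (\<lambda>d. run_policy A p G H (past @ [u]) us (apply_decision G u d M))"

definition history_pmf :: "'l set \<Rightarrow> real \<Rightarrow> 'l set pmf" where
  "history_pmf L p =
     map_pmf (\<lambda>b. {u \<in> L. b u}) (Pi_pmf L False (\<lambda>_. bernoulli_pmf p))"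

text \<open>An adversary chooses, for each history set, an enumeration of the online set.\<close>

definition arrival_order :: "'l set \<Rightarrow> ('l set \<Rightarrow> 'l list) \<Rightarrow> bool" where
  "arrival_order L \<sigma> \<longleftrightarrow> (\<forall>H \<subseteq> L. distinct (\<sigma> H) \<and> set (\<sigma> H) = L - H)"

definition expected_ALG ::
    "('l, 'r) policy \<Rightarrow> real \<Rightarrow> ('l, 'r) wgraph \<Rightarrow> ('l set \<Rightarrow> 'l list) \<Rightarrow> real" where
  "expected_ALG A p G \<sigma> =
     measure_pmf.expectation
       (bind_pmf (history_pmf (left G) p) (\<lambda>H. run_policy A p G H [] (\<sigma> H) {}))
       (sum (weight G))"

definition expected_OPT :: "real \<Rightarrow> ('l, 'r) wgraph \<Rightarrow> real" where
  "expected_OPT p G =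
     measure_pmf.expectation (history_pmf (left G) p)
       (\<lambda>H. max_matching_weight (induced G (left G - H)))"

definition competitive_AOS :: "real \<Rightarrow> ('l, 'r) policy \<Rightarrow> real \<Rightarrow> bool" where
  "competitive_AOS p A c \<longleftrightarrow>
     (\<forall>G \<sigma>. bipartite_wgraph G \<longrightarrow> arrival_order (left G) \<sigma> \<longrightarrow>
        expected_ALG A p G \<sigma> \<ge> c * expected_OPT p G)"


section \<open>The greedy-based algorithm\<close>

definition greedy_based :: "('l \<times> 'r) rel \<Rightarrow> ('l, 'r) policy" where
  "greedy_based tb p H K past u M =
     (let N = greedy tb (induced K (H \<union> {u}))
      in return_pmf
           (if \<exists>r. (u, r) \<in> N \<and> r \<notin> snd ` M
            then Some (THE r. (u, r) \<in> N)
            else None))"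

end

theory Submission
  imports Defs
begin

text \<open>Call an edge \<open>e = (u, r)\<close> a candidate for \<open>H\<close> if greedy on \<open>G[H \<union> {u}]\<close> selects it; this
  does not depend on whether \<open>u \<in> H\<close>. Every edge of a matching of \<open>G[O]\<close> can be charged
  injectively to a candidate of at least its weight, so \<open>OPT\<close> is at most the total weight of the
  candidates. On the other hand, whenever some online vertex is a candidate at \<open>r\<close>, the algorithm
  matches \<open>r\<close> by an online candidate, hence gains at least the weight of the last (lightest) one.
  Given that \<open>e\<close> is an online candidate, it is the last one at its right vertex with probability at
  least \<open>p\<close>, since moving the next online candidate into \<open>H\<close> removes all later ones. Being online
  contributes the independent factor \<open>1 - p\<close>.\<close>

section \<open>Greedy selection as a vertex set varies\<close>

text \<open>Since \<open>lt\<close> is a strict total order and \<open>E\<close> is finite, the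
  fixed-point equation \<open>S_iff\<close> determines \<open>S H\<close> by recursion along
  \<open>lt\<close>. It replaces the list-based run of greedy in all comparisons between vertex
  sets.\<close>

locale greedy_selection =
  fixes E :: "('l \<times> 'r) set"
    and lt :: "'l \<times> 'r \<Rightarrow> 'l \<times> 'r \<Rightarrow> bool"
    and S :: "'l set \<Rightarrow> ('l \<times> 'r) set"
  assumes finite_E: "finite E"
    and lt_irrefl: "\<not> lt e e"
    and lt_trans: "lt e f \<Longrightarrow> lt f g \<Longrightarrow> lt e g"
    and lt_total: "e \<noteq> f \<Longrightarrow> lt e f \<or> lt f e"
    and S_iff: "e \<in> S H \<longleftrightarrow>
      e \<in> E \<and> fst e \<in> H \<and> \<not> (\<exists>f\<in>S H. lt f e \<and> (fst f = fst e \<or> snd f = snd e))"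
begin

lemma S_subset: "S H \<subseteq> E"
  using S_iff by blast

lemma S_fst: "e \<in> S H \<Longrightarrow> fst e \<in> H"
  using S_iff by blast

lemma S_eq_if_adjacent:
  assumes "e \<in> S H" "f \<in> S H" "fst e = fst f \<or> snd e = snd f"
  shows "e = f"
proof (rule ccontr)
  assume "e \<noteq> f"
  then have "lt e f \<or> lt f e" by (rule lt_total)
  then show False
    using assms S_iff[of e H] S_iff[of f H] by metis
qed

lemma lt_induct [consumes 1, case_names less]:
  assumes "e \<in> E" and step: "\<And>e. e \<in> E \<Longrightarrow> (\<And>f. f \<in> E \<Longrightarrow> lt f e \<Longrightarrow> P f) \<Longrightarrow> P e"
  shows "P e"
  using assms(1)
proof (induction "card {f \<in> E. lt f e}" arbitrary: e rule: less_induct)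
  case less
  show ?case
  proof (rule step[OF less.prems])
    fix f assume f: "f \<in> E" "lt f e"
    then have "{g \<in> E. lt g f} \<subset> {g \<in> E. lt g e}"
      using lt_trans lt_irrefl by blast
    then have "card {g \<in> E. lt g f} < card {g \<in> E. lt g e}"
      using finite_E by (intro psubset_card_mono) auto
    then show "P f" using f(1) less.hyps by blast
  qed
qed

text \<open>Induction along \<open>lt\<close>: before \<open>e\<close>, an edge at \<open>v\<close>
  is selected in neither run, and every other edge meets the same earlier selections in both. So a
  new vertex leaves no trace until it is matched.\<close>

lemma S_insert_agree:
  assumes v: "v \<notin> X"
    and unmatched: "\<And>f. f \<in> S (insert v X) \<Longrightarrow> fst f = v \<Longrightarrow> \<not> lt f e"
    and f: "lt f e"
  shows "f \<in> S (insert v X) \<longleftrightarrow> f \<in> S X"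
proof (cases "f \<in> E")
  case True
  then show ?thesis
    using f
  proof (induction f rule: lt_induct)
    case (less f)
    show ?case
    proof (cases "fst f = v")
      case True
      then show ?thesis
        using unmatched less.prems S_fst v by blast
    next
      case False
      have "g \<in> S (insert v X) \<longleftrightarrow> g \<in> S X" if "lt g f" for g
        using less.IH[of g] that less.prems lt_trans S_subset by blast
      then show ?thesis
        using False S_iff[of f "insert v X"] S_iff[of f X] by blast
    qed
  qed
next
  case False
  then show ?thesis using S_subset by blast
qed

section \<open>The choice made by an added left vertex\<close>

definition covered_before :: "'l set \<Rightarrow> 'l \<times> 'r \<Rightarrow> bool" where
  "covered_before H e \<longleftrightarrow> (\<exists>f\<in>S H. lt f e \<and> snd f = snd e)"

text \<open>The runs with and without \<open>v\<close> agree before \<open>(v, r)\<close>. An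
  earlier edge \<open>(v, r')\<close> was rejected because of a selected edge, which cannot lie at
  \<open>v\<close> and hence lies at \<open>r'\<close>.\<close>

lemma covered_before_if_selected:
  assumes v: "v \<notin> H" and e: "(v, r) \<in> S (insert v H)"
  shows "\<not> covered_before H (v, r)"
    and "(v, r') \<in> E \<Longrightarrow> lt (v, r') (v, r) \<Longrightarrow> covered_before H (v, r')"
proof -
  have unm: "\<not> lt f (v, r)" if "f \<in> S (insert v H)" "fst f = v" for f
    using e that S_iff[of "(v, r)" "insert v H"] by auto
  have agree: "f \<in> S (insert v H) \<longleftrightarrow> f \<in> S H" if "lt f (v, r)" for f
    using S_insert_agree[OF v unm that] by blast
  show "\<not> covered_before H (v, r)"
    using e agree S_iff[of "(v, r)" "insert v H"] unfolding covered_before_def by auto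
  assume "(v, r') \<in> E" and lt: "lt (v, r') (v, r)"
  moreover have "(v, r') \<notin> S (insert v H)" using unm[of "(v, r')"] lt by auto
  ultimately obtain f where f: "f \<in> S (insert v H)" "lt f (v, r')" "fst f = v \<or> snd f = r'"
    using S_iff[of "(v, r')" "insert v H"] by auto
  then have "f \<in> S H" "snd f = r'"
    using unm[OF f(1)] agree lt_trans[OF f(2) lt] by blast+
  then show "covered_before H (v, r')"
    using f(2) unfolding covered_before_def by auto
qed

text \<open>This expresses the choice of \<open>v\<close> through \<open>S H\<close> alone, so that
  candidates for two histories can be compared by comparing coverage.\<close>

lemma selected_iff_first_uncovered:
  assumes v: "v \<notin> H"
  shows "(v, r) \<in> S (insert v H) \<longleftrightarrow>
    (v, r) \<in> E \<and> \<not> covered_before H (v, r) \<and>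
    (\<forall>r'. (v, r') \<in> E \<longrightarrow> lt (v, r') (v, r) \<longrightarrow> covered_before H (v, r'))"
    (is "?L \<longleftrightarrow> ?R")
proof
  assume ?L
  then show ?R using covered_before_if_selected[OF v] S_subset by blast
next
  assume R: ?R
  \<comment> \<open>A selected edge at \<open>v\<close> is uncovered, whereas \<open>R\<close> makes
    every edge of \<open>v\<close> before \<open>(v, r)\<close> covered.\<close>
  have unm: "\<not> lt f (v, r)" if "f \<in> S (insert v H)" "fst f = v" for f
    using R that covered_before_if_selected(1)[OF v, of "snd f"] S_subset
    by (metis prod.collapse subsetD)
  have agree: "f \<in> S (insert v H) \<longleftrightarrow> f \<in> S H" if "lt f (v, r)" for f
    using S_insert_agree[OF v unm that] by blast
  show ?L
    using R unm agree S_iff[of "(v, r)" "insert v H"] unfolding covered_before_def by auto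
qed

section \<open>Candidates and the upper bound on the optimum\<close>

definition candidates :: "'l set \<Rightarrow> ('l \<times> 'r) set" where
  "candidates H = {e \<in> E. e \<in> S (insert (fst e) H)}"

lemma candidates_subset: "candidates H \<subseteq> E"
  by (auto simp: candidates_def)

lemma finite_candidates: "finite (candidates H)"
  using candidates_subset finite_E finite_subset by blast

lemma candidates_iff: "e \<in> candidates H \<longleftrightarrow> e \<in> S (insert (fst e) H)"
  using S_subset by (auto simp: candidates_def)

lemma S_subset_candidates: "S H \<subseteq> candidates H"
  using S_fst candidates_iff by (metis insert_absorb subsetI)

lemma candidates_insert [simp]: "e \<in> candidates (insert (fst e) H) \<longleftrightarrow> e \<in> candidates H"
  by (simp add: candidates_iff)

lemma candidates_eq_if_fst_eq:
  assumes "e \<in> candidates H" "f \<in> candidates H" "fst e = fst f"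
  shows "e = f"
  using assms S_eq_if_adjacent by (metis candidates_iff)

lemma S_agree_before_candidate:
  assumes x: "x \<notin> H" and cand: "(x, r) \<in> candidates H" and lt: "lt f (x, r)"
  shows "f \<in> S (insert x H) \<longleftrightarrow> f \<in> S H"
proof (rule S_insert_agree[OF x _ lt])
  fix g assume "g \<in> S (insert x H)" "fst g = x"
  then show "\<not> lt g (x, r)"
    using cand S_eq_if_adjacent lt_irrefl by (metis candidates_iff fst_conv)
qed

text \<open>Moving \<open>x\<close> into the history alters the greedy run only from
  \<open>(x, r)\<close> onwards, and whether an edge is a candidate depends only on coverage by
  edges preceding it or preceding other, still earlier edges of its left vertex.\<close>

lemma candidates_before_candidate:
  assumes x: "x \<notin> H" and cand: "(x, r) \<in> candidates H"
    and v: "v \<notin> H" "v \<noteq> x" and lt: "lt (v, s) (x, r)"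
  shows "(v, s) \<in> candidates (insert x H) \<longleftrightarrow> (v, s) \<in> candidates H"
proof -
  have "covered_before (insert x H) e \<longleftrightarrow> covered_before H e" if "lt e (x, r)" for e
    using S_agree_before_candidate[OF x cand] lt_trans[OF _ that]
    unfolding covered_before_def by blast
  moreover have "v \<notin> insert x H" using v by simp
  ultimately show ?thesis
    using selected_iff_first_uncovered[of v H s] selected_iff_first_uncovered[of v "insert x H" s]
      v(1) lt lt_trans by (auto simp: candidates_iff insert_commute)
qed

text \<open>Either the left vertex of \<open>e\<close> is itself matched no later than
  \<open>e\<close>, or \<open>e\<close> is blocked at its right vertex by an earlier edge. In the
  second case the blocker is selected already in \<open>S H\<close>, so its left vertex is in
  \<open>H\<close>.\<close>

lemma matching_edge_dominated:
  assumes e: "e \<in> E" "fst e \<notin> H"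
  shows "\<exists>f\<in>candidates H. (f = e \<or> lt f e) \<and>
    (fst f = fst e \<or> fst f \<in> H \<and> snd f = snd e)"
proof (cases "\<exists>f\<in>S (insert (fst e) H). (f = e \<or> lt f e) \<and> fst f = fst e")
  case True
  then show ?thesis using candidates_iff by metis
next
  case False
  then have "e \<notin> S (insert (fst e) H)" by blast
  then obtain f where f: "f \<in> S (insert (fst e) H)" "lt f e" "fst f = fst e \<or> snd f = snd e"
    using e S_iff[of e "insert (fst e) H"] by auto
  moreover have "f \<in> S H"
    using S_insert_agree[OF e(2) _ f(2)] False f(1) by blast
  ultimately show ?thesis using False S_subset_candidates S_fst by blast
qed

lemma matching_weight_le_candidates:
  fixes w :: "'l \<times> 'r \<Rightarrow> real"
  assumes N: "N \<subseteq> E" "inj_on fst N" "inj_on snd N" "fst ` N \<inter> H = {}"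
    and nonneg: "\<And>e. e \<in> E \<Longrightarrow> 0 \<le> w e"
    and mono: "\<And>e f. e \<in> E \<Longrightarrow> f \<in> E \<Longrightarrow> lt e f \<Longrightarrow> w f \<le> w e"
  shows "sum w N \<le> sum w (candidates H)"
proof -
  have "\<forall>e\<in>N. \<exists>f. f \<in> candidates H \<and> (f = e \<or> lt f e) \<and>
      (fst f = fst e \<or> fst f \<in> H \<and> snd f = snd e)"
    using matching_edge_dominated N(1,4) by blast
  then obtain g where g: "\<And>e. e \<in> N \<Longrightarrow> g e \<in> candidates H \<and> (g e = e \<or> lt (g e) e) \<and>
      (fst (g e) = fst e \<or> fst (g e) \<in> H \<and> snd (g e) = snd e)"
    by metis
  \<comment> \<open>The left vertex of a common image decides which alternative holds for both
    edges: outside \<open>H\<close> it forces equal left ends, inside \<open>H\<close> equal right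
    ends.\<close>
  have "inj_on g N"
  proof (rule inj_onI)
    fix e f assume ef: "e \<in> N" "f \<in> N" "g e = g f"
    have "fst e \<notin> H" "fst f \<notin> H" using ef N(4) by auto
    then have "fst e = fst f \<or> snd e = snd f"
      using g[OF ef(1)] g[OF ef(2)] ef(3) by metis
    then show "e = f" using ef N(2,3) by (auto dest: inj_onD)
  qed
  have "sum w N \<le> sum (\<lambda>e. w (g e)) N"
  proof (rule sum_mono)
    fix e assume "e \<in> N"
    then show "w e \<le> w (g e)"
      using g[of e] mono[of "g e" e] N(1) candidates_subset by auto
  qed
  also have "\<dots> = sum w (g ` N)"
    using \<open>inj_on g N\<close> by (simp add: sum.reindex)
  also have "\<dots> \<le> sum w (candidates H)"
    by (rule sum_mono2[OF finite_candidates]) (use g nonneg candidates_subset in blast)+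
  finally show ?thesis .
qed

section \<open>Online candidates and the last one at each right vertex\<close>

definition online_candidates :: "'l set \<Rightarrow> ('l \<times> 'r) set" where
  "online_candidates H = {e \<in> candidates H. fst e \<notin> H}"

definition last_candidates :: "'l set \<Rightarrow> ('l \<times> 'r) set" where
  "last_candidates H =
    {e \<in> online_candidates H. \<forall>f\<in>online_candidates H. snd f = snd e \<longrightarrow> \<not> lt e f}"

lemma last_candidates_subset: "last_candidates H \<subseteq> online_candidates H"
  by (auto simp: last_candidates_def)

lemma online_candidates_subset: "online_candidates H \<subseteq> candidates H"
  by (auto simp: online_candidates_def)

text \<open>The arrival order may decide which online candidate occupies a right vertex, but each of
  them weighs at least as much as the last one there.\<close>

lemma last_candidates_weight_le:
  fixes w :: "'l \<times> 'r \<Rightarrow> real"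
  assumes N: "N \<subseteq> online_candidates H"
    and cover: "snd ` online_candidates H \<subseteq> snd ` N"
    and nonneg: "\<And>e. e \<in> E \<Longrightarrow> 0 \<le> w e"
    and mono: "\<And>e f. e \<in> E \<Longrightarrow> f \<in> E \<Longrightarrow> lt e f \<Longrightarrow> w f \<le> w e"
  shows "sum w (last_candidates H) \<le> sum w N"
proof -
  have NE: "N \<subseteq> E" "last_candidates H \<subseteq> E"
    using N online_candidates_subset last_candidates_subset candidates_subset by blast+
  have "\<forall>e\<in>last_candidates H. \<exists>f. f \<in> N \<and> snd f = snd e"
    using cover last_candidates_subset by (metis image_iff subsetD image_eqI)
  then obtain g where g: "\<And>e. e \<in> last_candidates H \<Longrightarrow> g e \<in> N \<and> snd (g e) = snd e"
    by metis
  have "inj_on g (last_candidates H)"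
  proof (rule inj_onI)
    fix e f assume ef: "e \<in> last_candidates H" "f \<in> last_candidates H" "g e = g f"
    then have "snd e = snd f" using g by metis
    then show "e = f"
      using ef lt_total[of e f] unfolding last_candidates_def by auto
  qed
  have "sum w (last_candidates H) \<le> sum (\<lambda>e. w (g e)) (last_candidates H)"
  proof (rule sum_mono)
    fix e assume e: "e \<in> last_candidates H"
    have "g e \<in> online_candidates H" using g[OF e] N by blast
    then have "\<not> lt e (g e)" using e g[OF e] unfolding last_candidates_def by blast
    then have "g e = e \<or> lt (g e) e" using lt_total by blast
    then show "w e \<le> w (g e)"
      using mono[of "g e" e] e g[OF e] NE by auto
  qed
  also have "\<dots> = sum w (g ` last_candidates H)"
    using \<open>inj_on g _\<close> by (simp add: sum.reindex)
  also have "\<dots> \<le> sum w N"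
    using g nonneg NE finite_subset[OF NE(1) finite_E] by (intro sum_mono2) auto
  finally show ?thesis .
qed

text \<open>The witness is the left end of the first online candidate after \<open>e\<close> at the
  same right vertex. Once \<open>x\<close> is in the history, greedy selects
  \<open>(x, snd e)\<close>, which blocks all later edges there and changes nothing before
  it.\<close>

lemma next_candidate_exists:
  assumes "e \<in> online_candidates H" "e \<notin> last_candidates H"
  shows "\<exists>x. (x, snd e) \<in> online_candidates H \<and> e \<in> last_candidates (insert x H)"
proof -
  obtain v r where e: "e = (v, r)" by (cases e)
  let ?later = "\<lambda>f. f \<in> online_candidates H \<and> snd f = r \<and> lt e f"
  obtain f0 where f0: "?later f0"
    using assms unfolding last_candidates_def e by auto
  have "f0 \<in> E" using f0 online_candidates_subset candidates_subset by blast
  then have "\<exists>f. ?later f \<and> (\<forall>g. ?later g \<longrightarrow> \<not> lt g f)"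
    using f0
  proof (induction f0 rule: lt_induct)
    case (less f)
    show ?case
    proof (cases "\<exists>g. ?later g \<and> lt g f")
      case True
      then obtain g where g: "?later g" "lt g f" by blast
      then have "g \<in> E" using online_candidates_subset candidates_subset by blast
      then show ?thesis using less.IH g by blast
    qed (use less.prems in blast)
  qed
  then obtain x where x: "?later (x, r)" and min: "\<And>g. ?later g \<Longrightarrow> \<not> lt g (x, r)"
    by (metis prod.collapse)
  have xH: "x \<notin> H" "(x, r) \<in> candidates H" using x by (auto simp: online_candidates_def)
  have vH: "v \<notin> H" "e \<in> candidates H" using assms(1) e by (auto simp: online_candidates_def)
  have "v \<noteq> x" using x e lt_irrefl by auto
  have "e \<in> online_candidates (insert x H)"
    using candidates_before_candidate[OF xH vH(1) \<open>v \<noteq> x\<close>, of r] x vH \<open>v \<noteq> x\<close> e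
    by (auto simp: online_candidates_def)
  moreover have "\<not> lt e f" if f: "f \<in> online_candidates (insert x H)" "snd f = r" for f
  proof
    assume lt: "lt e f"
    obtain y where y: "f = (y, r)" using f(2) by (cases f) auto
    have yH: "y \<notin> H" "y \<noteq> x" "f \<in> candidates (insert x H)"
      using f(1) y by (auto simp: online_candidates_def)
    have "f \<noteq> (x, r)" using yH y by auto
    then consider "lt f (x, r)" | "lt (x, r) f" using lt_total by blast
    then show False
    proof cases
      \<comment> \<open>Before \<open>(x, r)\<close> the candidates are unchanged, so
        \<open>f\<close> would be an online candidate for \<open>H\<close> between \<open>e\<close>
        and \<open>(x, r)\<close>, against minimality.\<close>
      case 1
      then have "f \<in> online_candidates H"
        using candidates_before_candidate[OF xH yH(1,2)] yH y by (auto simp: online_candidates_def)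
      then show False using min[of f] lt 1 f(2) by blast
    next
      case 2
      have "(x, r) \<in> S (insert x H)" using xH(2) by (simp add: candidates_iff)
      then have "covered_before (insert x H) f"
        using 2 y unfolding covered_before_def by auto
      moreover have "y \<notin> insert x H" "(y, r) \<in> S (insert y (insert x H))"
        using yH y by (auto simp: candidates_iff)
      ultimately show False
        using covered_before_if_selected(1) y by blast
    qed
  qed
  ultimately show ?thesis
    using x e unfolding last_candidates_def by auto
qed

text \<open>The factor \<open>1 - p\<close> comes from toggling \<open>fst e\<close>, the factor
  \<open>p\<close> from moving the next candidate into the history. The cross-multiplied form of
  \<open>move\<close> avoids dividing by \<open>1 - p\<close>.\<close>

lemma last_candidate_probability_ge:
  fixes P :: "'l set \<Rightarrow> real" and p :: real
  assumes L: "finite L" "fst ` E \<subseteq> L" and e: "e \<in> E" and p: "0 \<le> p" "p \<le> 1"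
    and nonneg: "\<And>H. H \<subseteq> L \<Longrightarrow> 0 \<le> P H"
    and move: "\<And>x H. H \<subseteq> L \<Longrightarrow> x \<in> L \<Longrightarrow> x \<notin> H \<Longrightarrow> (1 - p) * P (insert x H) = p * P H"
  shows "p * (1 - p) * sum P {H \<in> Pow L. e \<in> candidates H}
    \<le> sum P {H \<in> Pow L. e \<in> last_candidates H}"
proof -
  let ?D = "{H \<in> Pow L. e \<in> candidates H}"
  let ?A = "{H \<in> Pow L. e \<in> online_candidates H}"
  let ?B = "{H \<in> Pow L. e \<in> last_candidates H}"
  have fin: "finite ?D" "finite ?A" "finite ?B" using L(1) by auto
  have fstE: "fst f \<in> L" if "f \<in> E" for f using that L(2) by blast
  have BA: "?B \<subseteq> ?A" using last_candidates_subset by blast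
  \<comment> \<open>Being a candidate ignores whether \<open>fst e\<close> is in the history, so
    \<open>?D\<close> splits into pairs \<open>H\<close>, \<open>insert (fst e) H\<close> with
    \<open>H\<close> in \<open>?A\<close>.\<close>
  have D: "?D = ?A \<union> insert (fst e) ` ?A"
  proof (intro equalityI subsetI)
    fix H assume H: "H \<in> ?D"
    show "H \<in> ?A \<union> insert (fst e) ` ?A"
    proof (cases "fst e \<in> H")
      case True
      then have "H = insert (fst e) (H - {fst e})" by blast
      moreover from this have "H - {fst e} \<in> ?A"
        using H candidates_insert[of e "H - {fst e}"] by (auto simp: online_candidates_def)
      ultimately show ?thesis by blast
    qed (use H in \<open>auto simp: online_candidates_def\<close>)
  next
    fix H assume "H \<in> ?A \<union> insert (fst e) ` ?A"
    then show "H \<in> ?D" using fstE[OF e] by (auto simp: online_candidates_def)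
  qed
  have inj: "inj_on (insert (fst e)) ?A"
    by (rule inj_onI) (metis (no_types, lifting) insert_ident mem_Collect_eq online_candidates_def)
  have "sum P ?D = sum P ?A + sum P (insert (fst e) ` ?A)"
    unfolding D using fin(2) by (intro sum.union_disjoint) (auto simp: online_candidates_def)
  also have "sum P (insert (fst e) ` ?A) = (\<Sum>H\<in>?A. P (insert (fst e) H))"
    unfolding sum.reindex[OF inj] by simp
  finally have "(1 - p) * sum P ?D
      = (1 - p) * sum P ?A + (\<Sum>H\<in>?A. (1 - p) * P (insert (fst e) H))"
    by (simp add: distrib_left sum_distrib_left)
  also have "(\<Sum>H\<in>?A. (1 - p) * P (insert (fst e) H)) = (\<Sum>H\<in>?A. p * P H)"
    using move fstE[OF e] by (intro sum.cong refl) (auto simp: online_candidates_def)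
  finally have online: "(1 - p) * sum P ?D = sum P ?A"
    by (simp add: sum_distrib_left[symmetric] algebra_simps)
  have "\<forall>H\<in>?A - ?B. \<exists>x. (x, snd e) \<in> online_candidates H \<and> e \<in> last_candidates (insert x H)"
    using next_candidate_exists by auto
  from bchoice[OF this] obtain x where x: "\<And>H. H \<in> ?A - ?B \<Longrightarrow>
      (x H, snd e) \<in> online_candidates H \<and> e \<in> last_candidates (insert (x H) H)"
    by blast
  have xL: "x H \<in> L" "x H \<notin> H" "(x H, snd e) \<in> S (insert (x H) H)" if "H \<in> ?A - ?B" for H
    using x[OF that] fstE[of "(x H, snd e)"]
    by (auto simp: online_candidates_def candidates_def)
  \<comment> \<open>The moved vertex can be read off the image: greedy on it selects exactly one
    edge at \<open>snd e\<close>, and \<open>x H\<close> is its left end.\<close>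
  have inj2: "inj_on (\<lambda>H. insert (x H) H) (?A - ?B)"
  proof (rule inj_onI)
    fix H H' assume H: "H \<in> ?A - ?B" and H': "H' \<in> ?A - ?B"
      and eq: "insert (x H) H = insert (x H') H'"
    have "(x H, snd e) = (x H', snd e)"
      using S_eq_if_adjacent[OF xL(3)[OF H]] xL(3)[OF H'] eq by (metis snd_conv)
    then show "H = H'" using eq xL(2)[OF H] xL(2)[OF H'] by (metis Pair_inject insert_ident)
  qed
  have "p * sum P (?A - ?B) = (\<Sum>H\<in>?A - ?B. (1 - p) * P (insert (x H) H))"
    unfolding sum_distrib_left using move xL(1,2) by (intro sum.cong refl) auto
  also have "\<dots> = (1 - p) * sum P ((\<lambda>H. insert (x H) H) ` (?A - ?B))"
    unfolding sum.reindex[OF inj2] sum_distrib_left by simp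
  also have "\<dots> \<le> (1 - p) * sum P ?B"
    using x xL(1) nonneg fin(3) p by (intro mult_left_mono sum_mono2) auto
  \<comment> \<open>Adding \<open>p * sum P ?B\<close> to both sides merges \<open>?A - ?B\<close>
    with \<open>?B\<close> on the left and turns the factor \<open>1 - p\<close> into 1 on the
    right.\<close>
  finally have "p * sum P ?A \<le> sum P ?B"
    using sum.subset_diff[OF BA fin(2), of P] by (simp add: algebra_simps)
  then show ?thesis using online by (simp add: mult.assoc)
qed

text \<open>Exchanging the sums over histories and edges reduces the claim to the bound for a single
  edge, scaled by its nonnegative weight.\<close>

lemma last_candidates_expectation_ge:
  fixes P :: "'l set \<Rightarrow> real" and p :: real
  assumes L: "finite L" "fst ` E \<subseteq> L" and p: "0 \<le> p" "p \<le> 1"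
    and nonneg: "\<And>H. H \<subseteq> L \<Longrightarrow> 0 \<le> P H"
    and move: "\<And>x H. H \<subseteq> L \<Longrightarrow> x \<in> L \<Longrightarrow> x \<notin> H \<Longrightarrow> (1 - p) * P (insert x H) = p * P H"
    and w: "\<And>e. e \<in> E \<Longrightarrow> 0 \<le> w e"
  shows "p * (1 - p) * (\<Sum>H\<in>Pow L. sum w (candidates H) * P H)
    \<le> (\<Sum>H\<in>Pow L. sum w (last_candidates H) * P H)"
proof -
  have swap: "(\<Sum>H\<in>Pow L. sum w (X H) * P H) = (\<Sum>e\<in>E. w e * sum P {H \<in> Pow L. e \<in> X H})"
    if X: "\<And>H. X H \<subseteq> E" for X
  proof -
    have "(\<Sum>H\<in>Pow L. sum w (X H) * P H) = (\<Sum>H\<in>Pow L. \<Sum>e\<in>{e \<in> E. e \<in> X H}. w e * P H)"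
      using X by (intro sum.cong refl) (auto simp: sum_distrib_right intro!: sum.cong)
    also have "\<dots> = (\<Sum>e\<in>E. \<Sum>H\<in>{H \<in> Pow L. e \<in> X H}. w e * P H)"
      using finite_E L(1) by (intro sum.swap_restrict) auto
    finally show ?thesis by (simp add: sum_distrib_left)
  qed
  have "p * (1 - p) * (\<Sum>H\<in>Pow L. sum w (candidates H) * P H)
      = (\<Sum>e\<in>E. w e * (p * (1 - p) * sum P {H \<in> Pow L. e \<in> candidates H}))"
    unfolding swap[OF candidates_subset] sum_distrib_left[of "p * (1 - p)" _ E]
    by (intro sum.cong refl) (simp add: mult_ac)
  also have "\<dots> \<le> (\<Sum>e\<in>E. w e * sum P {H \<in> Pow L. e \<in> last_candidates H})"
    using last_candidate_probability_ge[OF L _ p nonneg move] w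
    by (intro sum_mono mult_left_mono) auto
  also have "\<dots> = (\<Sum>H\<in>Pow L. sum w (last_candidates H) * P H)"
    using last_candidates_subset online_candidates_subset candidates_subset
    by (intro swap[symmetric]) blast
  finally show ?thesis .
qed

end


section \<open>The greedy algorithm\<close>

lemma mem_greedy_add_self:
  assumes "a \<notin> M"
  shows "a \<in> greedy_add a M \<longleftrightarrow> (\<forall>f\<in>M. fst f \<noteq> fst a \<and> snd f \<noteq> snd a)"
  using assms by (auto simp: greedy_add_def image_iff) (metis fst_conv snd_conv)+

lemma mem_greedy_add_other: "e \<noteq> a \<Longrightarrow> e \<in> greedy_add a M \<longleftrightarrow> e \<in> M"
  by (simp add: greedy_add_def)

text \<open>Induction on the list from its end. The appended edge is preceded by all others, so its
  own test sees every earlier selection, and by antisymmetry it cannot block any of them.\<close>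

lemma mem_fold_greedy_add_iff:
  assumes "distinct es" "sorted_wrt Q es"
    and antisym: "\<And>e f. Q e f \<Longrightarrow> Q f e \<Longrightarrow> e = f"
  shows "e \<in> fold greedy_add es {} \<longleftrightarrow> e \<in> set es \<and>
    \<not> (\<exists>f\<in>fold greedy_add es {}. (Q f e \<and> f \<noteq> e) \<and> (fst f = fst e \<or> snd f = snd e))"
  using assms(1,2)
proof (induction es arbitrary: e rule: rev_induct)
  case Nil
  then show ?case by simp
next
  case (snoc a es)
  let ?M = "fold greedy_add es {}"
  have IH: "e \<in> ?M \<longleftrightarrow> e \<in> set es \<and>
      \<not> (\<exists>f\<in>?M. (Q f e \<and> f \<noteq> e) \<and> (fst f = fst e \<or> snd f = snd e))" for e
    using snoc.prems by (intro snoc.IH) (simp_all add: sorted_wrt_append)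
  have a: "a \<notin> set es" "\<And>f. f \<in> set es \<Longrightarrow> Q f a"
    using snoc.prems by (auto simp: sorted_wrt_append)
  have M: "f \<in> set es" if "f \<in> ?M" for f using IH[of f] that by (rule iffD1[THEN conjunct1])
  show ?case
  proof (cases "e = a")
    case True
    have "a \<notin> ?M" using a(1) M by blast
    then have "a \<in> greedy_add a ?M \<longleftrightarrow> (\<forall>f\<in>?M. fst f \<noteq> fst a \<and> snd f \<noteq> snd a)"
      by (rule mem_greedy_add_self)
    moreover have "f \<in> greedy_add a ?M \<and> f \<noteq> a \<longleftrightarrow> f \<in> ?M" for f
      using \<open>a \<notin> ?M\<close> mem_greedy_add_other by metis
    moreover have "Q f a" if "f \<in> ?M" for f using a(2) M that by blast
    moreover have "fold greedy_add (es @ [a]) {} = greedy_add a ?M" "a \<in> set (es @ [a])" by simp_all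
    ultimately show ?thesis unfolding True by metis
  next
    case False
    have "e \<in> set es \<Longrightarrow> \<not> Q a e" using a(2)[of e] antisym[of e a] False by blast
    then have "f \<in> greedy_add a ?M \<longleftrightarrow> f \<in> ?M" if "e \<in> set es" "Q f e" for f
      using that mem_greedy_add_other by metis
    moreover have "e \<in> fold greedy_add (es @ [a]) {} \<longleftrightarrow> e \<in> ?M"
      using False by (simp add: mem_greedy_add_other)
    moreover have "fold greedy_add (es @ [a]) {} = greedy_add a ?M"
      "e \<in> set (es @ [a]) \<longleftrightarrow> e \<in> set es"
      using False by simp_all
    ultimately show ?thesis using IH[of e] by metis
  qed
qed

section \<open>Greedy on induced subgraphs as an instance of the locale\<close>

definition strictly_before ::
    "('l \<times> 'r) rel \<Rightarrow> ('l, 'r) wgraph \<Rightarrow> 'l \<times> 'r \<Rightarrow> 'l \<times> 'r \<Rightarrow> bool" where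
  "strictly_before tb G e f \<longleftrightarrow> processed_before tb G e f \<and> e \<noteq> f"

lemma edges_induced [simp]: "edges (induced G U) = {e \<in> edges G. fst e \<in> U}"
  by (simp add: induced_def Let_def)

lemma weight_induced: "e \<in> edges (induced G U) \<Longrightarrow> weight (induced G U) e = weight G e"
  by (simp add: induced_def Let_def)

lemma induced_induced: "U \<subseteq> W \<Longrightarrow> induced (induced G W) U = induced G U"
  unfolding induced_def Let_def by (auto simp: restrict_def fun_eq_iff)

lemma mem_greedy_iff:
  assumes tb: "linear_order tb" and fin: "finite (edges K)"
  shows "e \<in> greedy tb K \<longleftrightarrow> e \<in> edges K \<and>
    \<not> (\<exists>f\<in>greedy tb K. strictly_before tb K f e \<and> (fst f = fst e \<or> snd f = snd e))"
proof -
  have es: "distinct (edge_list tb K) \<and> set (edge_list tb K) = edges K \<and>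
      sorted_wrt (processed_before tb K) (edge_list tb K)"
    unfolding edge_list_def by (rule theI') (rule edge_list_unique_exists[OF tb fin])
  have "e = f" if "processed_before tb K e f" "processed_before tb K f e" for e f
    using that tb by (auto simp: processed_before_def order_on_defs dest: antisymD)
  from mem_fold_greedy_add_iff[OF _ _ this] es show ?thesis
    unfolding greedy_def strictly_before_def by blast
qed

lemma greedy_selection_induced:
  assumes G: "bipartite_wgraph G" and tb: "linear_order tb"
  shows "greedy_selection (edges G) (strictly_before tb G) (\<lambda>H. greedy tb (induced G H))"
proof
  show fin: "finite (edges G)"
    using G unfolding bipartite_wgraph_def by (auto intro: finite_subset)
  have tb': "trans tb" "antisym tb" "total tb"
    using tb by (simp_all only: order_on_defs)
  fix e f g :: "'a \<times> 'b" and H :: "'a set"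
  show "\<not> strictly_before tb G e e" by (simp add: strictly_before_def)
  show "strictly_before tb G e g" if "strictly_before tb G e f" "strictly_before tb G f g"
    using that tb'(1,2) unfolding strictly_before_def processed_before_def
    by (auto dest: transD antisymD)
  show "strictly_before tb G e f \<or> strictly_before tb G f e" if "e \<noteq> f"
  proof -
    have "(e, f) \<in> tb \<or> (f, e) \<in> tb" using that tb'(3) unfolding total_on_def by blast
    then show ?thesis
      using that unfolding strictly_before_def processed_before_def by auto
  qed
  let ?K = "induced G H"
  have K: "e \<in> greedy tb ?K \<longleftrightarrow> e \<in> edges ?K \<and>
      \<not> (\<exists>f\<in>greedy tb ?K. strictly_before tb ?K f e \<and> (fst f = fst e \<or> snd f = snd e))" for e
    using fin by (intro mem_greedy_iff[OF tb]) simp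
  \<comment> \<open>The induced graph erases weights of absent edges, so the two orders are compared
    only on edges of \<open>?K\<close>. This suffices because greedy selects only such
    edges.\<close>
  have before: "strictly_before tb ?K f e \<longleftrightarrow> strictly_before tb G f e"
    if "e \<in> edges ?K" "f \<in> edges ?K" for e f
    using that by (simp add: strictly_before_def processed_before_def weight_induced)
  show "e \<in> greedy tb ?K \<longleftrightarrow> e \<in> edges G \<and> fst e \<in> H \<and>
      \<not> (\<exists>f\<in>greedy tb ?K. strictly_before tb G f e \<and> (fst f = fst e \<or> snd f = snd e))"
  proof (cases "e \<in> edges ?K")
    case True
    then have "strictly_before tb ?K f e \<longleftrightarrow> strictly_before tb G f e" if "f \<in> greedy tb ?K" for f
      using before K[of f] that by blast
    then show ?thesis using K[of e] True by auto
  next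
    case False
    then show ?thesis using K[of e] by auto
  qed
qed

text \<open>The run is deterministic. An arriving vertex has at most one candidate edge; either it
  is added or its right end is already taken. A general \<open>M\<close> and \<open>past\<close>
  carry this invariant through the induction.\<close>

lemma run_greedy_based:
  fixes G :: "('l, 'r) wgraph"
  assumes G: "bipartite_wgraph G" and tb: "linear_order tb"
  defines "on \<equiv> greedy_selection.online_candidates (edges G) (\<lambda>H. greedy tb (induced G H))"
  assumes "M \<subseteq> on H" "set us \<inter> H = {}"
  shows "\<exists>M'. run_policy (greedy_based tb) p G H past us M = return_pmf M' \<and>
    M \<subseteq> M' \<and> M' \<subseteq> on H \<and> (\<forall>e\<in>on H. fst e \<in> set us \<longrightarrow> snd e \<in> snd ` M')"
  using assms(4,5)
proof (induction us arbitrary: past M)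
  case Nil
  then show ?case by simp
next
  case (Cons u us)
  interpret greedy_selection "edges G" "strictly_before tb G" "\<lambda>H. greedy tb (induced G H)"
    by (rule greedy_selection_induced[OF G tb])
  let ?N = "greedy tb (induced G (insert u H))"
  \<comment> \<open>The revealed graph also contains earlier arrivals; the second restriction
    discards them, so the choice depends only on \<open>H\<close> and \<open>u\<close>.\<close>
  have N: "greedy tb (induced (induced G (H \<union> set past \<union> {u})) (H \<union> {u})) = ?N"
    by (subst induced_induced) auto
  have on: "(u, r) \<in> ?N \<longleftrightarrow> (u, r) \<in> on H" for r
    using Cons.prems(2) by (auto simp: on_def online_candidates_def candidates_iff)
  have on_eq: "e = f" if "e \<in> on H" "f \<in> on H" "fst e = fst f" for e f
    using that by (intro candidates_eq_if_fst_eq[of e H]) (auto simp: on_def online_candidates_def)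
  define d where "d = (if \<exists>r. (u, r) \<in> ?N \<and> r \<notin> snd ` M then Some (THE r. (u, r) \<in> ?N) else None)"
  define M1 where "M1 = apply_decision G u d M"
  have run: "run_policy (greedy_based tb) p G H past (u # us) M =
      run_policy (greedy_based tb) p G H (past @ [u]) us M1"
    unfolding run_policy.simps greedy_based_def N Let_def
    by (simp add: bind_return_pmf M1_def d_def)
  have M1: "M \<subseteq> M1 \<and> M1 \<subseteq> on H \<and> (\<forall>e\<in>on H. fst e = u \<longrightarrow> snd e \<in> snd ` M1)"
  proof (cases "\<exists>r. (u, r) \<in> ?N \<and> r \<notin> snd ` M")
    case True
    then obtain r where r: "(u, r) \<in> ?N" "r \<notin> snd ` M" by blast
    have uniq: "s = r" if "(u, s) \<in> ?N" for s
      using on_eq[of "(u, s)" "(u, r)"] that r(1) by (simp add: on)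
    have "(THE r. (u, r) \<in> ?N) = r" using r(1) uniq by (rule the_equality)
    then have "d = Some r" using True by (simp add: d_def)
    moreover have "(u, r) \<in> edges G" using r(1) S_subset by blast
    ultimately have "M1 = insert (u, r) M" using r by (simp add: M1_def apply_decision_def)
    moreover have "snd e = r" if "e \<in> on H" "fst e = u" for e
      using uniq[of "snd e"] on[of "snd e"] that by (cases e) simp
    moreover have "(u, r) \<in> on H" using r(1) on by blast
    ultimately show ?thesis using Cons.prems(1) by (simp add: subset_insertI)
  next
    case False
    then have "d = None" unfolding d_def by (rule if_not_P)
    then have "M1 = M" by (simp add: M1_def apply_decision_def)
    moreover have "snd e \<in> snd ` M" if "e \<in> on H" "fst e = u" for e
      using False on[of "snd e"] that by (metis prod.collapse)
    ultimately show ?thesis using Cons.prems(1) by simp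
  qed
  then obtain M' where M': "run_policy (greedy_based tb) p G H (past @ [u]) us M1 = return_pmf M'"
    "M1 \<subseteq> M'" "M' \<subseteq> on H" "\<forall>e\<in>on H. fst e \<in> set us \<longrightarrow> snd e \<in> snd ` M'"
    using Cons.IH[of M1 "past @ [u]"] Cons.prems(2) by auto
  moreover have "snd ` M1 \<subseteq> snd ` M'" using M'(2) by (rule image_mono)
  ultimately show ?case
    unfolding run using M1 by (intro exI[of _ M']) auto
qed


section \<open>The distribution of the history set\<close>

lemma pmf_history_pmf:
  assumes L: "finite L" "H \<subseteq> L" and p: "0 \<le> p" "p \<le> 1"
  shows "pmf (history_pmf L p) H = p ^ card H * (1 - p) ^ card (L - H)"
proof -
  let ?Q = "Pi_pmf L False (\<lambda>_. bernoulli_pmf p)"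
  let ?S = "\<lambda>b. {u \<in> L. b u}"
  have supp: "b u = False" if "b \<in> set_pmf ?Q" "u \<notin> L" for b u
    using that set_Pi_pmf_subset[OF L(1), of False] by blast
  have "pmf (history_pmf L p) H = measure ?Q (?S -` {H} \<inter> set_pmf ?Q)"
    unfolding history_pmf_def pmf_map measure_Int_set_pmf ..
  \<comment> \<open>On the support every function is \<open>False\<close> outside \<open>L\<close>,
    so the set it defines inside \<open>L\<close> determines it.\<close>
  also have "?S -` {H} \<inter> set_pmf ?Q = {\<lambda>u. u \<in> H} \<inter> set_pmf ?Q"
  proof (intro equalityI subsetI)
    fix b assume b: "b \<in> ?S -` {H} \<inter> set_pmf ?Q"
    have "b u = (u \<in> H)" for u using b supp[of b u] by (cases "u \<in> L") auto
    then have "b = (\<lambda>u. u \<in> H)" by (rule ext)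
    then show "b \<in> {\<lambda>u. u \<in> H} \<inter> set_pmf ?Q" using b by blast
  qed (use L(2) in auto)
  also have "measure ?Q ({\<lambda>u. u \<in> H} \<inter> set_pmf ?Q) = pmf ?Q (\<lambda>u. u \<in> H)"
    unfolding measure_Int_set_pmf by (simp add: measure_pmf_single)
  also have "\<dots> = (\<Prod>u\<in>L. pmf (bernoulli_pmf p) (u \<in> H))"
    using L by (intro pmf_Pi') auto
  also have "\<dots> = (\<Prod>u\<in>H. p) * (\<Prod>u\<in>L - H. 1 - p)"
    using L p by (subst prod.subset_diff[OF L(2,1)]) (simp add: mult.commute)
  finally show ?thesis by simp
qed

text \<open>Moving one vertex into the history trades one factor \<open>1 - p\<close> for one factor
  \<open>p\<close>; this instantiates the hypothesis \<open>move\<close>.\<close>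

lemma pmf_history_pmf_insert:
  assumes L: "finite L" "H \<subseteq> L" "x \<in> L" "x \<notin> H" and p: "0 \<le> p" "p \<le> 1"
  shows "(1 - p) * pmf (history_pmf L p) (insert x H) = p * pmf (history_pmf L p) H"
proof -
  have "finite H" using L finite_subset by blast
  then have c1: "card (insert x H) = Suc (card H)" using L by simp
  have "L - insert x H = L - H - {x}" by blast
  then have c2: "card (L - H) = Suc (card (L - insert x H))"
    using L by (metis DiffI card_Suc_Diff1 finite_Diff)
  have H': "insert x H \<subseteq> L" using L by blast
  show ?thesis
    unfolding pmf_history_pmf[OF L(1) H' p] pmf_history_pmf[OF L(1,2) p] c1 c2
    by (simp only: power_Suc mult_ac)
qed

lemma set_history_pmf: "set_pmf (history_pmf L p) \<subseteq> Pow L"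
  by (auto simp: history_pmf_def)

lemma expectation_history_pmf:
  assumes "finite L"
  shows "measure_pmf.expectation (history_pmf L p) f
    = (\<Sum>H\<in>Pow L. f H * pmf (history_pmf L p) H)"
  using assms set_history_pmf by (intro integral_measure_pmf_real) auto

section \<open>The competitive ratio\<close>

theorem theorem3p1:
  fixes p :: real and tb :: "('l \<times> 'r) rel"
  assumes "0 \<le> p" and "p \<le> 1/2" and "linear_order tb"
  shows "competitive_AOS p (greedy_based tb) (p * (1 - p))"
  unfolding competitive_AOS_def
proof (intro allI impI)
  fix G :: "('l, 'r) wgraph" and \<sigma>
  assume G: "bipartite_wgraph G" and \<sigma>: "arrival_order (left G) \<sigma>"
  let ?L = "left G" and ?w = "weight G"
  let ?P = "pmf (history_pmf ?L p)"
  have p: "0 \<le> p" "p \<le> 1" using assms by auto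
  have L: "finite ?L" "fst ` edges G \<subseteq> ?L" and w: "\<And>e. e \<in> edges G \<Longrightarrow> 0 \<le> ?w e"
    using G unfolding bipartite_wgraph_def by auto
  interpret greedy_selection "edges G" "strictly_before tb G" "\<lambda>H. greedy tb (induced G H)"
    by (rule greedy_selection_induced[OF G assms(3)])
  have mono: "\<And>e f. strictly_before tb G e f \<Longrightarrow> ?w f \<le> ?w e"
    by (auto simp: strictly_before_def processed_before_def)
  have opt: "max_matching_weight (induced G (?L - H)) \<le> sum ?w (candidates H)" if "H \<subseteq> ?L" for H
  proof -
    let ?K = "induced G (?L - H)"
    have "finite {N. matching ?K N}"
      by (rule finite_subset[of _ "Pow (edges G)"]) (auto simp: matching_def finite_E)
    moreover have "matching ?K {}" by (simp add: matching_def)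
    moreover have "sum (weight ?K) N \<le> sum ?w (candidates H)" if "matching ?K N" for N
    proof -
      have "sum (weight ?K) N = sum ?w N"
        using that unfolding matching_def by (intro sum.cong refl weight_induced) blast
      also have "\<dots> \<le> sum ?w (candidates H)"
        using that w mono unfolding matching_def by (intro matching_weight_le_candidates) auto
      finally show ?thesis .
    qed
    ultimately show ?thesis
      unfolding max_matching_weight_def by (subst Max_le_iff) auto
  qed
  have "\<exists>M'. run_policy (greedy_based tb) p G H [] (\<sigma> H) {} = return_pmf M' \<and>
      sum ?w (last_candidates H) \<le> sum ?w M'" if "H \<subseteq> ?L" for H
  proof -
    have \<sigma>H: "set (\<sigma> H) = ?L - H" using \<sigma> that by (simp add: arrival_order_def)
    obtain M' where M': "run_policy (greedy_based tb) p G H [] (\<sigma> H) {} = return_pmf M'"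
      "M' \<subseteq> online_candidates H"
      "\<forall>e\<in>online_candidates H. fst e \<in> ?L - H \<longrightarrow> snd e \<in> snd ` M'"
      using run_greedy_based[OF G assms(3), of "{}" H "\<sigma> H" p "[]"] \<sigma>H by auto
    have "snd ` online_candidates H \<subseteq> snd ` M'"
      using M'(3) L(2) by (auto simp: online_candidates_def candidates_def)
    then show ?thesis
      using M'(1) last_candidates_weight_le[OF M'(2), of ?w] w mono by blast
  qed
  \<comment> \<open>Each run is a point mass, so a function \<open>F\<close> of the history gives
    the output and the expectation is over the history alone.\<close>
  then obtain F where F: "\<And>H. H \<subseteq> ?L \<Longrightarrow>
      run_policy (greedy_based tb) p G H [] (\<sigma> H) {} = return_pmf (F H) \<and>
      sum ?w (last_candidates H) \<le> sum ?w (F H)"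
    by meson
  have "p * (1 - p) * expected_OPT p G
      \<le> p * (1 - p) * (\<Sum>H\<in>Pow ?L. sum ?w (candidates H) * ?P H)"
    unfolding expected_OPT_def expectation_history_pmf[OF L(1)]
    using opt p by (intro mult_left_mono sum_mono mult_right_mono) auto
  also have "\<dots> \<le> (\<Sum>H\<in>Pow ?L. sum ?w (last_candidates H) * ?P H)"
    using w by (intro last_candidates_expectation_ge L p pmf_history_pmf_insert) auto
  also have "\<dots> \<le> (\<Sum>H\<in>Pow ?L. sum ?w (F H) * ?P H)"
    using F by (intro sum_mono mult_right_mono) auto
  also have "\<dots> = measure_pmf.expectation (map_pmf F (history_pmf ?L p)) (sum ?w)"
    by (simp add: expectation_history_pmf[OF L(1)])
  also have "map_pmf F (history_pmf ?L p) =
      bind_pmf (history_pmf ?L p) (\<lambda>H. run_policy (greedy_based tb) p G H [] (\<sigma> H) {})"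
    unfolding map_pmf_def
  proof (rule bind_pmf_cong[OF refl])
    fix H assume "H \<in> set_pmf (history_pmf ?L p)"
    then have "H \<subseteq> ?L" using set_history_pmf by blast
    then show "return_pmf (F H) = run_policy (greedy_based tb) p G H [] (\<sigma> H) {}"
      using F by simp
  qed
  finally show "expected_ALG (greedy_based tb) p G \<sigma> \<ge> p * (1 - p) * expected_OPT p G"
    unfolding expected_ALG_def .
qed

end
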